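(* Let $K$ be a simplicial complex and $L\subseteq K$ a subcomplex. Then $TC(K,L)\leq TC(K)$.
   Context: Simplicial complexes are abstract simplicial complexes. The categorical product $K\prod L$ has vertex set $V(K)\times V(L)$, and a finite set $\sigma$ of vertices is a simplex iff its projections $p_1(\sigma)$ and $p_2(\sigma)$ are simplices of $K$ and $L$ respectively; $K^2=K\prod K$. Two simplicial maps $\phi,\psi:K\to M$ are contiguous, $\phi\sim_c\psi$, if $\phi(\sigma)\cup\psi(\sigma)$ is a simplex of $M$ for every simplex $\sigma$ of $K$. They are in the same contiguity class, $\phi\sim\psi$, if there is a finite sequence of simplicial maps $\phi=\phi_0\sim_c\phi_1\sim_c\cdots\sim_c\phi_n=\psi$. The discrete topological complexity $TC(K)$ is the least integer $n\ge0$ such that $K^2$ can be covered by $n+1$ subcomplexes $\Omega_0,\dots,\Omega_n$ such that for each $j$ there is a simplicial map $\sigma_j:\Omega_j\to K$ with $\Delta\circ\sigma_j\sim i_{\Omega_j}$, where $\Delta:K\to K^2$ is the diagonal map and $i_{\Omega_j}:\Omega_j\to K^2$ the inclusion. For a subcomplex $L\subseteq K$, the targeted simplicial complexity $TC(K,L)$ is the least integer $n\ge 0$ such that $K\prod L$ can be covered by $n+1$ subcomplexes $\Omega_0,\dots,\Omega_n$ such that for each $i$ there is a simplicial map $\sigma_i:\Omega_i\to L$ with $\Delta_L\circ\sigma_i\sim i_{\Omega_i}$, where $\Delta_L:L\to K\prod L$, $\Delta_L(v)=(v,v)$, and $i_{\Omega_i}:\Omega_i\to K\prod L$ is the inclusion.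 Both invariants are $\infty$ if no such $n$ exists. *)

theory Defs
  imports Main "HOL-Library.Extended_Nat"
begin

text \<open>
  An abstract simplicial complex is given by its set of simplices, which are finite and non-empty;
  the vertices are the points occurring in a simplex.  Complexes may be infinite, and the empty
  complex is allowed.
\<close>

definition simplicial_complex :: "'a set set \<Rightarrow> bool" where
  "simplicial_complex K \<longleftrightarrow>
     (\<forall>s\<in>K. finite s \<and> s \<noteq> {}) \<and> (\<forall>s\<in>K. \<forall>t. t \<subseteq> s \<longrightarrow> t \<noteq> {} \<longrightarrow> t \<in> K)"

definition vertices :: "'a set set \<Rightarrow> 'a set" where
  "vertices K = \<Union>K"

definition subcomplex :: "'a set set \<Rightarrow> 'a set set \<Rightarrow> bool" where
  "subcomplex L K \<longleftrightarrow> simplicial_complex L \<and> L \<subseteq> K"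

definition cat_prod :: "'a set set \<Rightarrow> 'b set set \<Rightarrow> ('a \<times> 'b) set set" where
  "cat_prod K L =
     {s. finite s \<and> s \<subseteq> vertices K \<times> vertices L \<and> fst ` s \<in> K \<and> snd ` s \<in> L}"

text \<open>
  Simplicial maps are represented by total functions on the vertex type.  Values outside
  the vertex set of the domain are irrelevant: maps agreeing on the vertices are contiguous.
\<close>

definition simplicial_map :: "'a set set \<Rightarrow> 'b set set \<Rightarrow> ('a \<Rightarrow> 'b) \<Rightarrow> bool" where
  "simplicial_map K M f \<longleftrightarrow> (\<forall>s\<in>K. f ` s \<in> M)"

definition contiguous :: "'a set set \<Rightarrow> 'b set set \<Rightarrow> ('a \<Rightarrow> 'b) \<Rightarrow> ('a \<Rightarrow> 'b) \<Rightarrow> bool" where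
  "contiguous K M f g \<longleftrightarrow>
     simplicial_map K M f \<and> simplicial_map K M g \<and> (\<forall>s\<in>K. f ` s \<union> g ` s \<in> M)"

definition same_contiguity_class ::
    "'a set set \<Rightarrow> 'b set set \<Rightarrow> ('a \<Rightarrow> 'b) \<Rightarrow> ('a \<Rightarrow> 'b) \<Rightarrow> bool" where
  "same_contiguity_class K M f g \<longleftrightarrow>
     simplicial_map K M f \<and> simplicial_map K M g \<and> (contiguous K M)\<^sup>*\<^sup>* f g"

definition diagonal :: "'a \<Rightarrow> 'a \<times> 'a" where
  "diagonal v = (v, v)"

text \<open>
  In the two invariants below the inclusion of a subcomplex is \<open>id\<close>, members of a cover may be
  empty, and the infimum of the empty set in \<^typ>\<open>enat\<close> is \<open>\<infinity>\<close>.
\<close>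

definition TC :: "'a set set \<Rightarrow> enat" where
  "TC K = Inf {enat n |n. \<exists>\<Omega> :: nat \<Rightarrow> ('a \<times> 'a) set set.
     (\<forall>j\<le>n. subcomplex (\<Omega> j) (cat_prod K K)) \<and>
     (\<Union>j\<le>n. \<Omega> j) = cat_prod K K \<and>
     (\<forall>j\<le>n. \<exists>\<sigma>. simplicial_map (\<Omega> j) K \<sigma> \<and>
        same_contiguity_class (\<Omega> j) (cat_prod K K) (diagonal \<circ> \<sigma>) id)}"

definition targeted_TC :: "'a set set \<Rightarrow> 'a set set \<Rightarrow> enat" where
  "targeted_TC K L = Inf {enat n |n. \<exists>\<Omega> :: nat \<Rightarrow> ('a \<times> 'a) set set.
     (\<forall>i\<le>n. subcomplex (\<Omega> i) (cat_prod K L)) \<and>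
     (\<Union>i\<le>n. \<Omega> i) = cat_prod K L \<and>
     (\<forall>i\<le>n. \<exists>\<sigma>. simplicial_map (\<Omega> i) L \<sigma> \<and>
        same_contiguity_class (\<Omega> i) (cat_prod K L) (diagonal \<circ> \<sigma>) id)}"

lemma simplicial_complex_cat_prod:
  assumes "simplicial_complex K" and "simplicial_complex L"
  shows "simplicial_complex (cat_prod K L)"
proof -
  have "t \<in> cat_prod K L" if s: "s \<in> cat_prod K L" and t: "t \<subseteq> s" "t \<noteq> {}" for s t
  proof -
    have "fst ` t \<in> K" "snd ` t \<in> L"
      using assms s t unfolding simplicial_complex_def cat_prod_def
      by (metis (no_types, lifting) image_is_empty image_mono mem_Collect_eq)+
    then show ?thesis
      using s t finite_subset unfolding cat_prod_def by blast
  qed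
  moreover have "finite s \<and> s \<noteq> {}" if "s \<in> cat_prod K L" for s
    using assms that by (auto simp: cat_prod_def simplicial_complex_def)
  ultimately show ?thesis
    unfolding simplicial_complex_def by blast
qed

lemma vertices_cat_prod:
  assumes "simplicial_complex K" and "simplicial_complex L"
  shows "vertices (cat_prod K L) = vertices K \<times> vertices L"
proof
  show "vertices (cat_prod K L) \<subseteq> vertices K \<times> vertices L"
    unfolding vertices_def cat_prod_def by blast
  show "vertices K \<times> vertices L \<subseteq> vertices (cat_prod K L)"
  proof
    fix x assume x: "x \<in> vertices K \<times> vertices L"
    then have "{fst x} \<in> K" "{snd x} \<in> L"
      using assms unfolding vertices_def simplicial_complex_def by auto
    then have "{x} \<in> cat_prod K L"
      using x by (auto simp: cat_prod_def)
    then show "x \<in> vertices (cat_prod K L)"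
      unfolding vertices_def by blast
  qed
qed

end

theory Submission
  imports Defs
begin

text \<open>
  If \<open>\<sigma>\<close> is a simplicial map on a subcomplex \<open>\<Omega>\<close> of \<open>K\<^sup>2\<close> whose composite with the diagonal lies
  in the contiguity class of the inclusion, then composing with the two projections of \<open>K\<^sup>2\<close>
  gives \<open>\<sigma> \<sim> fst\<close> and \<open>\<sigma> \<sim> snd\<close>, hence \<open>snd \<sim> fst\<close> as maps \<open>\<Omega> \<rightarrow> K\<close>
  (\<open>projections_same_contiguity_class\<close>).  After this step \<open>\<sigma>\<close> can be forgotten.  This matters,
  because on the part of \<open>\<Omega>\<close> inside \<open>K \<Prod> L\<close> the values of \<open>\<sigma>\<close> need not lie in \<open>L\<close>, but those of
  \<open>snd\<close> do.  So \<open>snd\<close> serves as the new map into \<open>L\<close>: a sequence of contiguities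
  from \<open>snd\<close> to \<open>fst\<close> in \<open>K\<close>, paired with the constant sequence \<open>snd\<close> in \<open>L\<close>, leads from
  \<open>(snd, snd)\<close>, which is the diagonal composed with \<open>snd\<close>, to \<open>(fst, snd)\<close>, which is the inclusion,
  and it stays in \<open>K \<Prod> L\<close> throughout (\<open>diagonal_snd_same_contiguity_class\<close>).
  Intersecting every member of a cover of \<open>K\<^sup>2\<close> with \<open>K \<Prod> L\<close> therefore turns a cover that is
  admissible for \<open>TC K\<close> into one of the same size that is admissible for the targeted invariant.
\<close>

lemma same_contiguity_class_sym:
  assumes "same_contiguity_class K M f g"
  shows "same_contiguity_class K M g f"
proof -
  have "symp (contiguous K M)"
    by (auto intro!: sympI simp: contiguous_def Un_commute)
  then have "symp (contiguous K M)\<^sup>*\<^sup>*"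
    by (rule symp_rtranclp)
  then show ?thesis
    using assms unfolding same_contiguity_class_def by (blast dest: sympD)
qed

lemma same_contiguity_class_trans:
  assumes "same_contiguity_class K M f g" and "same_contiguity_class K M g h"
  shows "same_contiguity_class K M f h"
  using assms by (auto simp: same_contiguity_class_def)

text \<open>
  Restriction, composition and pairing all act on maps one at a time and respect a single
  contiguity; applying such an operation to each map of a sequence shows that it respects
  contiguity classes.
\<close>

lemma same_contiguity_class_map:
  assumes fg: "same_contiguity_class K M f g"
    and F: "\<And>f g. contiguous K M f g \<Longrightarrow> contiguous K' M' (F f) (F g)"
  shows "same_contiguity_class K' M' (F f) (F g)"
proof -
  have "(contiguous K M)\<^sup>*\<^sup>* f g"
    using fg by (simp add: same_contiguity_class_def)
  then have "(contiguous K' M')\<^sup>*\<^sup>* (F f) (F g)"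
    by induction (auto intro: F rtranclp.rtrancl_into_rtrancl)
  \<comment> \<open>A map is simplicial iff it is contiguous to itself, so \<open>F\<close> also preserves simplicial maps.\<close>
  moreover have "simplicial_map K' M' (F h)" if "simplicial_map K M h" for h
    using F[of h h] that by (simp add: contiguous_def simplicial_map_def)
  ultimately show ?thesis
    using fg by (simp add: same_contiguity_class_def)
qed

lemma same_contiguity_class_subset:
  assumes "same_contiguity_class K M f g" and "J \<subseteq> K"
  shows "same_contiguity_class J M f g"
  using assms(1)
proof (rule same_contiguity_class_map)
  show "contiguous J M f g" if "contiguous K M f g" for f g
    using that assms(2) by (auto simp: contiguous_def simplicial_map_def)
qed

lemma same_contiguity_class_comp:
  assumes "same_contiguity_class K M f g" and h: "simplicial_map M N h"
  shows "same_contiguity_class K N (h \<circ> f) (h \<circ> g)"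
  using assms(1)
proof (rule same_contiguity_class_map)
  show "contiguous K N (h \<circ> f) (h \<circ> g)" if "contiguous K M f g" for f g
    using that h unfolding contiguous_def simplicial_map_def
    by (simp only: image_comp[symmetric] image_Un[symmetric]) blast
qed

lemma simplicial_map_fst: "simplicial_map (cat_prod K L) K fst"
  by (simp add: simplicial_map_def cat_prod_def)

lemma simplicial_map_snd: "simplicial_map (cat_prod K L) L snd"
  by (simp add: simplicial_map_def cat_prod_def)

lemma in_cat_prod_iff: "s \<in> cat_prod K L \<longleftrightarrow> finite s \<and> fst ` s \<in> K \<and> snd ` s \<in> L"
  by (force simp: cat_prod_def vertices_def)

lemma cat_prod_mono:
  assumes "L \<subseteq> M"
  shows "cat_prod K L \<subseteq> cat_prod K M"
  using assms by (auto simp: in_cat_prod_iff)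

lemma same_contiguity_class_pair:
  assumes J: "simplicial_complex J"
    and "same_contiguity_class J K f g" and h: "simplicial_map J L h"
  shows "same_contiguity_class J (cat_prod K L) (\<lambda>x. (f x, h x)) (\<lambda>x. (g x, h x))"
  using assms(2)
proof (rule same_contiguity_class_map)
  show "contiguous J (cat_prod K L) (\<lambda>x. (f x, h x)) (\<lambda>x. (g x, h x))"
    if "contiguous J K f g" for f g
    using that J h
    by (simp add: contiguous_def simplicial_map_def simplicial_complex_def in_cat_prod_iff
        image_Un image_image)
qed

lemma simplicial_complex_Int:
  assumes "simplicial_complex J" and "simplicial_complex K"
  shows "simplicial_complex (J \<inter> K)"
  unfolding simplicial_complex_def
proof (intro conjI ballI allI impI IntI)
  fix s assume s: "s \<in> J \<inter> K"
  then show "finite s" and "s \<noteq> {}"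
    using assms(1) by (auto simp: simplicial_complex_def)
  fix t assume "t \<subseteq> s" and "t \<noteq> {}"
  with s show "t \<in> J" and "t \<in> K"
    using assms unfolding simplicial_complex_def by (metis IntD1, metis IntD2)
qed

lemma projections_same_contiguity_class:
  assumes "same_contiguity_class \<Omega> (cat_prod K K) (diagonal \<circ> \<sigma>) id"
  shows "same_contiguity_class \<Omega> K snd fst"
proof -
  have "same_contiguity_class \<Omega> K \<sigma> fst"
    using same_contiguity_class_comp[OF assms simplicial_map_fst]
    by (simp add: comp_def diagonal_def)
  moreover have "same_contiguity_class \<Omega> K \<sigma> snd"
    using same_contiguity_class_comp[OF assms simplicial_map_snd]
    by (simp add: comp_def diagonal_def)
  ultimately show ?thesis
    by (rule same_contiguity_class_trans[OF same_contiguity_class_sym, rotated])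
qed

text \<open>
  Only the first coordinate has to be moved, and it may move through all of \<open>K\<close>; the second
  coordinate stays fixed, so it never leaves \<open>L\<close>.
\<close>

lemma diagonal_snd_same_contiguity_class:
  assumes J: "subcomplex J (cat_prod K L)" and "same_contiguity_class J K snd fst"
  shows "same_contiguity_class J (cat_prod K L) (diagonal \<circ> snd) id"
proof -
  have "simplicial_map J L snd"
    using J simplicial_map_snd[of K L] by (auto simp: subcomplex_def simplicial_map_def)
  then have "same_contiguity_class J (cat_prod K L) (\<lambda>x. (snd x, snd x)) (\<lambda>x. (fst x, snd x))"
    using assms by (intro same_contiguity_class_pair) (simp_all add: subcomplex_def)
  then show ?thesis
    by (simp add: comp_def diagonal_def id_def)
qed

theorem corollary3p5:
  fixes K L :: "'a set set"
  assumes "simplicial_complex K" and "subcomplex L K"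
  shows "targeted_TC K L \<le> TC K"
proof -
  have KL: "simplicial_complex (cat_prod K L)" and sub: "cat_prod K L \<subseteq> cat_prod K K"
    using assms by (simp_all add: subcomplex_def simplicial_complex_cat_prod cat_prod_mono)
  have refine: "\<exists>\<Omega>' :: nat \<Rightarrow> ('a \<times> 'a) set set.
     (\<forall>i\<le>n. subcomplex (\<Omega>' i) (cat_prod K L)) \<and>
     (\<Union>i\<le>n. \<Omega>' i) = cat_prod K L \<and>
     (\<forall>i\<le>n. \<exists>\<sigma>. simplicial_map (\<Omega>' i) L \<sigma> \<and>
        same_contiguity_class (\<Omega>' i) (cat_prod K L) (diagonal \<circ> \<sigma>) id)"
    if \<Omega>: "\<forall>j\<le>n. subcomplex (\<Omega> j) (cat_prod K K)"
      and cover: "(\<Union>j\<le>n. \<Omega> j) = cat_prod K K"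
      and \<sigma>: "\<forall>j\<le>n. \<exists>\<sigma>. simplicial_map (\<Omega> j) K \<sigma> \<and>
        same_contiguity_class (\<Omega> j) (cat_prod K K) (diagonal \<circ> \<sigma>) id"
    for n and \<Omega> :: "nat \<Rightarrow> ('a \<times> 'a) set set"
  proof (intro exI[of _ "\<lambda>i. \<Omega> i \<inter> cat_prod K L"] conjI allI impI exI[of _ snd])
    show "(\<Union>i\<le>n. \<Omega> i \<inter> cat_prod K L) = cat_prod K L"
      using cover sub by blast
  next
    fix i assume i: "i \<le> n"
    show J: "subcomplex (\<Omega> i \<inter> cat_prod K L) (cat_prod K L)"
      using \<Omega> i KL by (simp add: subcomplex_def simplicial_complex_Int)
    show "simplicial_map (\<Omega> i \<inter> cat_prod K L) L snd"
      using simplicial_map_snd[of K L] by (simp add: simplicial_map_def)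
    have "same_contiguity_class (\<Omega> i) K snd fst"
      using \<sigma> i projections_same_contiguity_class by blast
    then have "same_contiguity_class (\<Omega> i \<inter> cat_prod K L) K snd fst"
      by (rule same_contiguity_class_subset) blast
    with J show "same_contiguity_class (\<Omega> i \<inter> cat_prod K L) (cat_prod K L) (diagonal \<circ> snd) id"
      by (rule diagonal_snd_same_contiguity_class)
  qed
  show ?thesis
    unfolding targeted_TC_def TC_def
  proof (intro Inf_superset_mono Collect_mono impI, elim exE conjE)
    fix x n and \<Omega> :: "nat \<Rightarrow> ('a \<times> 'a) set set"
    assume x: "x = enat n"
      and \<Omega>: "\<forall>j\<le>n. subcomplex (\<Omega> j) (cat_prod K K)"
        "(\<Union>j\<le>n. \<Omega> j) = cat_prod K K"
        "\<forall>j\<le>n. \<exists>\<sigma>. simplicial_map (\<Omega> j) K \<sigma> \<and>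
          same_contiguity_class (\<Omega> j) (cat_prod K K) (diagonal \<circ> \<sigma>) id"
    show "\<exists>n. x = enat n \<and> (\<exists>\<Omega>' :: nat \<Rightarrow> ('a \<times> 'a) set set.
        (\<forall>i\<le>n. subcomplex (\<Omega>' i) (cat_prod K L)) \<and>
        (\<Union>i\<le>n. \<Omega>' i) = cat_prod K L \<and>
        (\<forall>i\<le>n. \<exists>\<sigma>. simplicial_map (\<Omega>' i) L \<sigma> \<and>
          same_contiguity_class (\<Omega>' i) (cat_prod K L) (diagonal \<circ> \<sigma>) id))"
      by (rule exI[of _ n], rule conjI[OF x refine[OF \<Omega>]])
  qed
qed

end
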